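(* For every positive integer $i$ there exist positive integers $n, a, \beta$ such that $$a=(\beta-1)n+\beta^{2}+\beta+1 ,\qquad \beta=2i-1 ,$$ and $$N:=n^{3}+(n+1)^{3}=(n+a)^{3}-(n+a-\beta)^{3},$$ where, with the integer $b$ defined by $n+b=-(n+a)+\beta$ (so that $N=n^3+(n+1)^3=(n+a)^3+(n+b)^3$), these quantities are given by $$n=\frac{(2i-1)\left(3(2i-1)^{2}+4\right)-1}{2},$$ $$N=\frac{(2i-1)\left(3(2i-1)^{2}+4\right)\left((2i-1)^{2}\left(3(2i-1)^{2}+4\right)^{2}+3\right)}{4},$$ $$n+a=\frac{3(2i-1)^{2}\left((2i-1)^{2}+2\right)+2i+1}{2},$$ $$n+b=-\frac{3(2i-1)^{2}\left((2i-1)^{2}+2\right)-2i+3}{2}.$$ In particular, this gives an infinite family (indexed by $i$, i.e. by odd $\beta$) of solutions of $n^{3}+(n+1)^{3}=(n+a)^{3}-(n+a-\beta)^{3}$.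
   Context: The problem is to find positive integers $N$ that can be written both as a sum of two consecutive cubes $n^3+(n+1)^3$ and as a sum of two other integer cubes $(n+a)^3+(n+b)^3$, with $a>0$ and $b<0$ integers. One sets $n+b=-(n+a)+\beta$, i.e. $\beta=2n+a+b$. *)

theory Defs imports Complex_Main begin

(* The last conjunct is the equation in terms of n, a, beta; given the defining equation
   of b it agrees with the preceding one.  The condition b < 0 excludes the trivial
   representation a = 1, b = 0. *)
definition cube_solution :: "int \<Rightarrow> int \<Rightarrow> int \<Rightarrow> int \<Rightarrow> int \<Rightarrow> bool" where
  "cube_solution n a b \<beta> N \<longleftrightarrow>
     n > 0 \<and> a > 0 \<and> b < 0 \<and> \<beta> > 0 \<and>
     n + b = - (n + a) + \<beta> \<and>
     N = n ^ 3 + (n + 1) ^ 3 \<and>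
     N = (n + a) ^ 3 + (n + b) ^ 3 \<and>
     N = (n + a) ^ 3 - (n + a - \<beta>) ^ 3"

(* The fractions are exact divisions in the reals, not truncating integer division. *)
definition closed_forms :: "int \<Rightarrow> int \<Rightarrow> int \<Rightarrow> int \<Rightarrow> int \<Rightarrow> int \<Rightarrow> bool" where
  "closed_forms i n a b \<beta> N \<longleftrightarrow>
     \<beta> = 2 * i - 1 \<and>
     a = (\<beta> - 1) * n + \<beta> ^ 2 + \<beta> + 1 \<and>
     real_of_int n =
       real_of_int ((2 * i - 1) * (3 * (2 * i - 1) ^ 2 + 4) - 1) / 2 \<and>
     real_of_int N =
       real_of_int ((2 * i - 1) * (3 * (2 * i - 1) ^ 2 + 4) *
         ((2 * i - 1) ^ 2 * (3 * (2 * i - 1) ^ 2 + 4) ^ 2 + 3)) / 4 \<and>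
     real_of_int (n + a) =
       real_of_int (3 * (2 * i - 1) ^ 2 * ((2 * i - 1) ^ 2 + 2) + 2 * i + 1) / 2 \<and>
     real_of_int (n + b) =
       - (real_of_int (3 * (2 * i - 1) ^ 2 * ((2 * i - 1) ^ 2 + 2) - 2 * i + 3) / 2)"

end

theory Submission imports Defs begin

text \<open>With s = 2n + 1 and t = 2(n + a) - \<beta>, the equation becomes s(s^2 + 3) =
  \<beta>(\<beta>^2 + 3t^2). The choice s = \<beta>(3\<beta>^2 + 4) makes t^2 a perfect square in
  \<beta>, with t = 3\<beta>^4 + 6\<beta>^2 + 2, so every \<beta> gives a solution; for odd \<beta>
  both s and t are odd, so n and a are integers. \<open>cube_family_exists\<close> checks these
  polynomial identities and the signs. Distinct \<open>i\<close> give distinct \<beta>, hence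
  infinitely many triples.\<close>

lemma cube_family_exists:
  fixes i :: int
  assumes "i > 0"
  shows "\<exists>n a b \<beta> N. cube_solution n a b \<beta> N \<and> closed_forms i n a b \<beta> N"
proof -
  \<comment> \<open>In terms of \<open>k = i - 1\<close> all quantities are polynomials whose coefficients show the signs.\<close>
  define k where "k = i - 1"
  have k: "k \<ge> 0" and i: "i = k + 1" using assms by (simp_all add: k_def)
  define \<beta> where "\<beta> = 2 * k + 1"
  \<comment> \<open>This is 2n + 1 = \<beta>(3\<beta>^2 + 4) solved for n, expanded at \<beta> = 2k
    + 1.\<close>
  define n where "n = 12 * k ^ 3 + 18 * k ^ 2 + 13 * k + 3"
  define a where "a = (\<beta> - 1) * n + \<beta> ^ 2 + \<beta> + 1"
  define b where "b = \<beta> - 2 * n - a"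
  define N where "N = n ^ 3 + (n + 1) ^ 3"
  have \<beta>_pos: "\<beta> > 0" using k by (simp add: \<beta>_def)
  \<comment> \<open>A linear bound in \<open>k\<close> is enough for all the sign
    conditions.\<close>
  have n_ge: "n \<ge> 13 * k + 3" using k by (simp add: n_def)
  have "(\<beta> - 1) * n \<ge> 0" using k n_ge by (simp add: \<beta>_def)
  moreover have "\<beta> ^ 2 \<ge> 0" by simp
  ultimately have a_pos: "a > 0" using \<beta>_pos unfolding a_def by linarith
  have b_neg: "b < 0" using a_pos k n_ge by (simp add: b_def \<beta>_def)
  have sum_cubes: "N = (n + a) ^ 3 + (n + b) ^ 3"
    unfolding N_def b_def a_def \<beta>_def n_def by algebra
  have "(n + b) ^ 3 = - ((n + a - \<beta>) ^ 3)" unfolding b_def by algebra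
  then have "N = (n + a) ^ 3 - (n + a - \<beta>) ^ 3" using sum_cubes by simp
  then have solution: "cube_solution n a b \<beta> N"
    using \<beta>_pos n_ge k a_pos b_neg sum_cubes by (simp add: cube_solution_def N_def b_def)
  have \<beta>_i: "2 * i - 1 = \<beta>" by (simp add: \<beta>_def i)
  \<comment> \<open>The closed forms with denominators cleared, in the shape they take once
    \<open>2 * i - 1\<close> is folded to \<beta>; the other occurrences of \<open>i\<close>
    therefore remain in \<open>na2\<close> and \<open>nb2\<close>. Each numerator becomes a visible
    multiple of its denominator, so the real divisions are exact.\<close>
  have n2: "\<beta> * (3 * \<beta> ^ 2 + 4) - 1 = 2 * n"
    unfolding \<beta>_def n_def by algebra
  have N4: "\<beta> * (3 * \<beta> ^ 2 + 4) * (\<beta> ^ 2 * (3 * \<beta> ^ 2 + 4) ^ 2 + 3) = 4 * N"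
    unfolding N_def \<beta>_def n_def by algebra
  have na2: "3 * \<beta> ^ 2 * (\<beta> ^ 2 + 2) + 2 * i + 1 = 2 * (n + a)"
    unfolding i a_def \<beta>_def n_def by algebra
  have nb2: "3 * \<beta> ^ 2 * (\<beta> ^ 2 + 2) - 2 * i + 3 = - (2 * (n + b))"
    unfolding i b_def a_def \<beta>_def n_def by algebra
  have "closed_forms i n a b \<beta> N"
    unfolding closed_forms_def \<beta>_i n2 N4 na2 nb2 by (simp add: a_def field_simps)
  with solution show ?thesis by blast
qed

theorem theorem1:
  "(\<forall>i::int. i > 0 \<longrightarrow>
      (\<exists>n a b \<beta> N. cube_solution n a b \<beta> N \<and> closed_forms i n a b \<beta> N)) \<and>
   infinite {(n, a, \<beta>). \<exists>i b N. i > 0 \<and>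
      cube_solution n a b \<beta> N \<and> closed_forms i n a b \<beta> N}"
  (is "_ \<and> infinite ?S")
proof
  show "\<forall>i::int. i > 0 \<longrightarrow>
      (\<exists>n a b \<beta> N. cube_solution n a b \<beta> N \<and> closed_forms i n a b \<beta> N)"
    using cube_family_exists by blast
  show "infinite ?S"
  proof
    assume "finite ?S"
    \<comment> \<open>The projection to \<beta> reaches every positive odd integer, so a finite
      solution set would make these finite in number.\<close>
    moreover have "(\<lambda>i. 2 * i - 1) ` {0<..} \<subseteq> (\<lambda>(n, a, \<beta>). \<beta>) ` ?S"
    proof
      fix \<beta> :: int
      assume "\<beta> \<in> (\<lambda>i. 2 * i - 1) ` {0<..}"
      then obtain i where "i > 0" "\<beta> = 2 * i - 1" by auto
      moreover from cube_family_exists[OF \<open>i > 0\<close>] obtain n a b \<beta>' N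
        where "cube_solution n a b \<beta>' N" "closed_forms i n a b \<beta>' N" by blast
      moreover from this have "\<beta>' = 2 * i - 1" by (simp add: closed_forms_def)
      ultimately have "(n, a, \<beta>) \<in> ?S" by blast
      then show "\<beta> \<in> (\<lambda>(n, a, \<beta>). \<beta>) ` ?S" by (rule rev_image_eqI) simp
    qed
    ultimately have "finite ((\<lambda>i::int. 2 * i - 1) ` {0<..})"
      using finite_surj by blast
    then have "finite {0::int<..}" by (rule finite_imageD) (simp add: inj_on_def)
    then show False by (simp add: infinite_Ioi)
  qed
qed

end
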